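(* Let $f,g:[0,b]\to[0,b]$ be continuous, strictly increasing Allee maps with fixed points $0<A_f<K_f$ and $0<A_g<K_g$ respectively, and assume $A_f<A_g<K_f<K_g$. Let $p\in(0,1)$ and take $\delta>0$ such that the sets $$U_1=\{x\in(0,A_f):\ \min(x-f(x),\,x-g(x))\ge\delta\},$$ $$U_2=\{x\in(A_g,K_f):\ \min(f(x)-x,\,g(x)-x)\ge\delta\},$$ $$U_3=\{x\in(K_g,b):\ \min(x-f(x),\,x-g(x))\ge\delta\}$$ are nonempty. Assume that for every $x\in[0,b]$ there exists $x^*\in[0,b]$ with $x^*\ge x$ such that $\min(x^*-f(x^* ),\,x^*-g(x^* ))\ge\delta$. Let $w_i=\inf U_i$ for $i=1,2,3$ and $z_j=\sup U_j$ for $j=1,2$. Let $\{Y_n\}_{n=0}^\infty$ be the random dynamical system with $Y_0=y_0\in[0,b]$ in which $Y_{n+1}=\chi(f(Y_n)+\varepsilon_n)$ with probability $p$ and $Y_{n+1}=\chi(g(Y_n)+\varepsilon_n)$ with probability $1-p$, where the $\varepsilon_n$ are i.i.d. continuous random variables taking values in $(-\delta,\delta)$ with a density that is positive on $(-\delta,\delta)$. Put $$p_0= P\left(\exists n_0\in\mathbb{N}:\ Y_n\in[0,w_1)\ \ \forall n\ge n_0\right),\qquad p_1= P\left(\exists n_0\in\mathbb{N}:\ Y_n\in(z_2,w_3)\ \ \forall n\ge n_0\right).$$ Then: (i) if $y_0\in[0,z_1]$, then $p_0=1$; (ii) if $y_0\in[w_2,b]$, then $p_1=1$; (iii) if $y_0\in(z_1,w_2)$,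 then $p_0>0$, $p_1>0$ and $p_0+p_1=1$.
   Context: Here $0<b\le\infty$, and if $b=\infty$ then $[0,b]$ is understood as $[0,\infty)$. A function $f:[0,b]\to[0,b]$ is called an Allee map if: it has exactly three fixed points, namely $0$, which is a stable fixed point, an unstable fixed point (threshold) $A_f>0$, and a fixed point $K_f>A_f$ (which may or may not be stable); $f(x)<x$ for all $x\in(0,A_f)\cup(K_f,b]$; and $f(x)>x$ for all $x\in(A_f,K_f)$. The notation $A_g,K_g$ is the analogous one for $g$. The function $\chi:\mathbb{R}\to\mathbb{R}$ is the truncation to $[0,b]$: $\chi(x)=0$ if $x<0$, $\chi(x)=x$ if $x\in[0,b]$, $\chi(x)=b$ if $x>b$. Formally, $Y_{n+1}=\chi(H_n(Y_n)+\varepsilon_n)$, where the $H_n$ are i.i.d. random functions with $P(H_n=f)=p$ and $P(H_n=g)=1-p$, the sequence $(H_n)$ is independent of the sequence $(\varepsilon_n)$, and $y_0$ is deterministic. *)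

theory Defs
  imports "HOL-Probability.Probability"
begin

(* The interval [0, b] for 0 < b \<le> \<infinity>; for b = \<infinity> it is the half-line [0, \<infinity>). *)
definition phase_space :: "ereal \<Rightarrow> real set" where
  "phase_space b = {x. 0 \<le> x \<and> ereal x \<le> b}"

(* The truncation chi. The last branch is reached only for b < \<infinity>. *)
definition trunc :: "ereal \<Rightarrow> real \<Rightarrow> real" where
  "trunc b x = (if x < 0 then 0 else if ereal x \<le> b then x else real_of_ereal b)"

(* Stability is meant in the sense of Lyapunov, relative to the domain S of the map. *)
definition stable_fixed_point :: "real set \<Rightarrow> (real \<Rightarrow> real) \<Rightarrow> real \<Rightarrow> bool" where
  "stable_fixed_point S f q \<longleftrightarrow> q \<in> S \<and> f q = q \<and>
     (\<forall>e>0. \<exists>d>0. \<forall>x\<in>S. \<bar>x - q\<bar> < d \<longrightarrow> (\<forall>n. \<bar>(f ^^ n) x - q\<bar> < e))"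

definition unstable_fixed_point :: "real set \<Rightarrow> (real \<Rightarrow> real) \<Rightarrow> real \<Rightarrow> bool" where
  "unstable_fixed_point S f q \<longleftrightarrow> q \<in> S \<and> f q = q \<and> \<not> stable_fixed_point S f q"

(* Only the values of f on phase_space b are constrained. A and K are determined by f:
   they are its two nonzero fixed points in increasing order. *)
definition allee_map :: "ereal \<Rightarrow> (real \<Rightarrow> real) \<Rightarrow> real \<Rightarrow> real \<Rightarrow> bool" where
  "allee_map b f A K \<longleftrightarrow>
     f \<in> phase_space b \<rightarrow> phase_space b \<and>
     0 < A \<and> A < K \<and>
     {x \<in> phase_space b. f x = x} = {0, A, K} \<and>
     stable_fixed_point (phase_space b) f 0 \<and>
     unstable_fixed_point (phase_space b) f A \<and>
     (\<forall>x\<in>phase_space b. 0 < x \<and> x < A \<or> K < x \<longrightarrow> f x < x) \<and>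
     (\<forall>x\<in>phase_space b. A < x \<and> x < K \<longrightarrow> x < f x)"

(* Pathwise recursion driven by random maps H n and additive noise eps n. *)
primrec random_orbit ::
  "ereal \<Rightarrow> (nat \<Rightarrow> 'w \<Rightarrow> real \<Rightarrow> real) \<Rightarrow> (nat \<Rightarrow> 'w \<Rightarrow> real) \<Rightarrow> real \<Rightarrow> nat \<Rightarrow> 'w \<Rightarrow> real" where
  "random_orbit b H eps y0 0 \<omega> = y0"
| "random_orbit b H eps y0 (Suc n) \<omega> =
     trunc b (H n \<omega> (random_orbit b H eps y0 n \<omega>) + eps n \<omega>)"

end

theory Submission imports Defs begin

text \<open>
  Since the maps are increasing and the noise stays below \<open>\<delta>\<close>, a point \<open>x\<close> with
  \<open>f x, g x \<le> x - \<delta>\<close> is never crossed upwards and one with \<open>f x, g x \<ge> x + \<delta>\<close> never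
  downwards; this makes \<open>[0,w\<^sub>1)\<close> and \<open>(z\<^sub>2,w\<^sub>3)\<close> absorbing. The orbit almost surely does not
  stay in any of the regions between these barriers: whenever it is at a point where
  \<open>f\<close> does not decrease (respectively increase) it, a sufficiently long run of steps using \<open>f\<close> and
  noise of size at least \<open>\<delta>/2\<close> in the matching direction pushes it out, and such a run,
  being independent of the past, has a probability bounded below. From \<open>(z\<^sub>1,w\<^sub>2)\<close> both barriers
  are reachable because there one map moves down after adding \<open>-\<delta>\<close> and one moves up after
  adding \<open>\<delta>\<close>, uniformly on compact intervals.
\<close>

section \<open>Phase space and truncation\<close>

lemma phase_space_interval:
  "l \<in> phase_space b \<Longrightarrow> u \<in> phase_space b \<Longrightarrow> {l..u} \<subseteq> phase_space b"
  by (auto simp: phase_space_def intro: order_trans[of _ "ereal u" b])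

lemma phase_space_borel [measurable]: "phase_space b \<in> sets borel"
  unfolding phase_space_def by measurable

lemma trunc_borel [measurable]: "trunc b \<in> borel_measurable borel"
  unfolding trunc_def by measurable

lemma trunc_in_phase_space: "0 < b \<Longrightarrow> trunc b x \<in> phase_space b"
  by (cases b) (auto simp: trunc_def phase_space_def)

text \<open>Truncation lifts negative values to 0, so a strict upper bound survives only if it is
  positive; dually, in \<open>less_trunc\<close> a strict lower bound survives only if it lies below
  \<open>b\<close>.\<close>

lemma trunc_less: "x < u \<Longrightarrow> 0 < u \<Longrightarrow> 0 < b \<Longrightarrow> trunc b x < u"
  by (cases b) (auto simp: trunc_def)

lemma trunc_le: "x \<le> u \<Longrightarrow> 0 \<le> u \<Longrightarrow> 0 < b \<Longrightarrow> trunc b x \<le> u"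
  by (cases b) (auto simp: trunc_def)

lemma less_trunc: "l < x \<Longrightarrow> ereal l < b \<Longrightarrow> 0 < b \<Longrightarrow> l < trunc b x"
  by (cases b) (auto simp: trunc_def)

lemma le_trunc: "l \<le> x \<Longrightarrow> ereal l \<le> b \<Longrightarrow> 0 < b \<Longrightarrow> l \<le> trunc b x"
  by (cases b) (auto simp: trunc_def)

section \<open>Random choice between two monotone maps with additive noise\<close>

text \<open>The locale fixes the driving sequences; drift conditions on the maps are supplied lemma
  by lemma. \<open>H_eps_indep\<close> concerns the sigma-algebras generated by the two whole
  sequences, each seen as one map into a product space.\<close>

locale noisy_pair = prob_space M for M :: "'w measure" +
  fixes b :: ereal and f g :: "real \<Rightarrow> real" and p \<delta> y0 :: real
    and H :: "nat \<Rightarrow> 'w \<Rightarrow> real \<Rightarrow> real" and eps :: "nat \<Rightarrow> 'w \<Rightarrow> real" and h :: "real \<Rightarrow> ennreal"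
  assumes b_pos: "0 < b"
    and f_cont: "continuous_on (phase_space b) f"
    and g_cont: "continuous_on (phase_space b) g"
    and f_mono: "mono_on (phase_space b) f"
    and g_mono: "mono_on (phase_space b) g"
    and p_bounds: "0 < p" "p < 1"
    and \<delta>_pos: "0 < \<delta>"
    and H_indep: "indep_vars (\<lambda>_. count_space {f, g}) H UNIV"
    and H_f: "\<And>n. prob {\<omega> \<in> space M. H n \<omega> = f} = p"
    and H_g: "\<And>n. prob {\<omega> \<in> space M. H n \<omega> = g} = 1 - p"
    and eps_indep: "indep_vars (\<lambda>_. borel) eps UNIV"
    and eps_distr: "\<And>n. distributed M lborel (eps n) h"
    and h_pos: "\<And>x. - \<delta> < x \<Longrightarrow> x < \<delta> \<Longrightarrow> 0 < h x"
    and eps_bounds: "\<And>n. AE \<omega> in M. - \<delta> < eps n \<omega> \<and> eps n \<omega> < \<delta>"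
    and H_eps_indep: "indep_set
           (sets (vimage_algebra (space M) (\<lambda>\<omega> n. H n \<omega>) (\<Pi>\<^sub>M n\<in>UNIV. count_space {f, g})))
           (sets (vimage_algebra (space M) (\<lambda>\<omega> n. eps n \<omega>) (\<Pi>\<^sub>M n\<in>UNIV. borel)))"
    and y0_in: "y0 \<in> phase_space b"
begin

abbreviation Y :: "nat \<Rightarrow> 'w \<Rightarrow> real" where
  "Y \<equiv> random_orbit b H eps y0"

abbreviation input_space :: "((real \<Rightarrow> real) \<times> real) measure" where
  "input_space \<equiv> count_space {f, g} \<Otimes>\<^sub>M borel"

abbreviation input :: "nat \<Rightarrow> 'w \<Rightarrow> (real \<Rightarrow> real) \<times> real" where
  "input n \<omega> \<equiv> (H n \<omega>, eps n \<omega>)"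

lemma H_measurable [measurable]: "H n \<in> M \<rightarrow>\<^sub>M count_space {f, g}"
  using H_indep by (auto simp: indep_vars_def)

lemma eps_measurable [measurable]: "eps n \<in> borel_measurable M"
  using eps_indep by (auto simp: indep_vars_def)

lemma H_cases: "\<omega> \<in> space M \<Longrightarrow> H n \<omega> = f \<or> H n \<omega> = g"
  using measurable_space[OF H_measurable] by auto

lemma Y_in: "Y n \<omega> \<in> phase_space b"
  by (cases n) (auto intro: y0_in trunc_in_phase_space b_pos)

section \<open>Independence of the inputs\<close>

text \<open>The event is a cylinder event of \<open>H\<close> intersected with a cylinder event of
  \<open>eps\<close>. Independence of the two sequences separates these, and independence within
  each sequence then splits both into products.\<close>

lemma prob_input_rect:
  assumes J: "J \<noteq> {}" "finite J"
    and a: "\<And>j. j \<in> J \<Longrightarrow> a j \<subseteq> {f, g}" and B: "\<And>j. j \<in> J \<Longrightarrow> B j \<in> sets borel"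
  shows "prob (\<Inter>j\<in>J. input j -` (a j \<times> B j) \<inter> space M) =
    (\<Prod>j\<in>J. prob (H j -` a j \<inter> space M)) * (\<Prod>j\<in>J. prob (eps j -` B j \<inter> space M))"
proof -
  let ?P = "\<Inter>j\<in>J. H j -` a j \<inter> space M" and ?Q = "\<Inter>j\<in>J. eps j -` B j \<inter> space M"
  have P: "?P \<in> sets (vimage_algebra (space M) (\<lambda>\<omega> n. H n \<omega>) (\<Pi>\<^sub>M n\<in>UNIV. count_space {f, g}))"
  proof -
    have "?P = (\<lambda>\<omega> n. H n \<omega>) -` {x \<in> space (\<Pi>\<^sub>M n\<in>UNIV. count_space {f, g}). \<forall>j\<in>J. x j \<in> a j} \<inter> space M"
      using J H_cases by (auto simp: space_PiM)
    moreover have "{x \<in> space (\<Pi>\<^sub>M n\<in>UNIV. count_space {f, g}). \<forall>j\<in>J. x j \<in> a j}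
        \<in> sets (\<Pi>\<^sub>M n\<in>UNIV. count_space {f, g})"
      using a J by (intro sets.sets_Collect_finite_All')
        (auto intro!: measurable_sets_Collect[OF measurable_component_singleton])
    ultimately show ?thesis
      by (simp only: in_vimage_algebra)
  qed
  have Q: "?Q \<in> sets (vimage_algebra (space M) (\<lambda>\<omega> n. eps n \<omega>) (\<Pi>\<^sub>M n\<in>UNIV. borel))"
  proof -
    have "?Q = (\<lambda>\<omega> n. eps n \<omega>) -` {x \<in> space (\<Pi>\<^sub>M n\<in>UNIV. borel). \<forall>j\<in>J. x j \<in> B j} \<inter> space M"
      using J by (auto simp: space_PiM)
    moreover have "{x \<in> space (\<Pi>\<^sub>M n\<in>UNIV. borel). \<forall>j\<in>J. x j \<in> B j} \<in> sets (\<Pi>\<^sub>M n\<in>UNIV. borel)"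
      using B J(2) by measurable
    ultimately show ?thesis
      by (simp only: in_vimage_algebra)
  qed
  have "(\<Inter>j\<in>J. input j -` (a j \<times> B j) \<inter> space M) = ?P \<inter> ?Q"
    using J by auto
  also have "prob \<dots> = prob ?P * prob ?Q"
    by (rule indep_setD[OF H_eps_indep P Q])
  also have "prob ?P = (\<Prod>j\<in>J. prob (H j -` a j \<inter> space M))"
    using J a by (intro indep_varsD[OF H_indep]) auto
  also have "prob ?Q = (\<Prod>j\<in>J. prob (eps j -` B j \<inter> space M))"
    using J B by (intro indep_varsD[OF eps_indep]) auto
  finally show ?thesis .
qed

text \<open>Measurable rectangles form an intersection-stable generator of the product
  sigma-algebra, so it is enough to verify the product formula on them.\<close>

lemma input_indep: "indep_vars (\<lambda>_. input_space) input {..n}"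
proof -
  let ?E = "{a \<times> B |a B. a \<in> sets (count_space {f, g}) \<and> B \<in> sets (borel :: real measure)}"
  have prods: "prob (\<Inter>j\<in>{..n}. input j -` A j \<inter> space M) = (\<Prod>j\<in>{..n}. prob (input j -` A j \<inter> space M))"
    if "A \<in> {..n} \<rightarrow> ?E" for A
  proof -
    from that have "\<forall>j\<in>{..n}. \<exists>a B. A j = a \<times> B \<and> a \<subseteq> {f, g} \<and> B \<in> sets borel"
      by (force simp: Pi_iff)
    then obtain a B where AB: "\<And>j. j \<le> n \<Longrightarrow> A j = a j \<times> B j"
        "\<And>j. j \<le> n \<Longrightarrow> a j \<subseteq> {f, g}" "\<And>j. j \<le> n \<Longrightarrow> B j \<in> sets borel"
      unfolding atMost_iff Ball_def by metis
    have "prob (\<Inter>j\<in>{..n}. input j -` A j \<inter> space M) =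
        (\<Prod>j\<in>{..n}. prob (H j -` a j \<inter> space M)) * (\<Prod>j\<in>{..n}. prob (eps j -` B j \<inter> space M))"
      using prob_input_rect[of "{..n}" a B] AB by simp
    also have "\<dots> = (\<Prod>j\<in>{..n}. prob (H j -` a j \<inter> space M) * prob (eps j -` B j \<inter> space M))"
      by (simp add: prod.distrib)
    also have "\<dots> = (\<Prod>j\<in>{..n}. prob (input j -` A j \<inter> space M))"
    proof (rule prod.cong)
      fix j assume "j \<in> {..n}"
      then show "prob (H j -` a j \<inter> space M) * prob (eps j -` B j \<inter> space M) =
          prob (input j -` A j \<inter> space M)"
        \<comment> \<open>The one-index instance identifies each factor of the product.\<close>
        using prob_input_rect[of "{j}" a B] AB by simp
    qed simp
    finally show ?thesis .
  qed
  have sp: "space input_space \<in> ?E"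
    unfolding space_pair_measure space_borel space_count_space
    by (intro CollectI exI[of _ "{f, g}"] exI[of _ UNIV]) simp
  have gen: "sets input_space = sigma_sets (space input_space) ?E"
    unfolding space_pair_measure by (rule sets_pair_measure)
  have E: "?E \<subseteq> Pow (space input_space)"
    by (auto simp: space_pair_measure)
  have rv: "random_variable input_space (input i)" for i
    by measurable
  have "{..n} \<noteq> {}" by auto
  from indep_vars_finite[where E = "\<lambda>_. ?E" and X = input and M' = "\<lambda>_. input_space",
      OF this finite_atMost gen rv Int_stable_pair_measure_generator sp E]
  show ?thesis
    by (rule iffD2) (intro ballI prods)
qed

section \<open>The natural filtration\<close>

text \<open>The information carried by the inputs with index below \<open>n\<close>. Since
  \<open>input n\<close> drives the step from \<open>Y n\<close> to \<open>Y (Suc n)\<close>,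
  \<open>Y n\<close> is already determined here while \<open>input n\<close> is still fresh.\<close>

definition past :: "nat \<Rightarrow> 'w measure" where
  "past n = vimage_algebra (space M) (\<lambda>\<omega>. \<lambda>i\<in>{..<n}. input i \<omega>) (\<Pi>\<^sub>M i\<in>{..<n}. input_space)"

lemma space_past [simp]: "space (past n) = space M"
  by (simp add: past_def)

text \<open>The index blocks \<open>{..<n}\<close> and \<open>{n}\<close> are disjoint parts of a
  finite independent family, and \<open>D\<close> is pulled back from the first block.\<close>

lemma past_indep:
  assumes D: "D \<in> sets (past n)" and C: "C \<in> sets input_space"
  shows "prob (D \<inter> (input n -` C \<inter> space M)) = prob D * prob (input n -` C \<inter> space M)"
proof -
  let ?r = "\<lambda>\<omega>. \<lambda>i\<in>{..<n}. input i \<omega>"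
  have "?r \<in> space M \<rightarrow> space (\<Pi>\<^sub>M i\<in>{..<n}. input_space)"
    using H_cases by (auto simp: space_PiM space_pair_measure)
  then obtain Q where Q: "Q \<in> sets (\<Pi>\<^sub>M i\<in>{..<n}. input_space)" "D = ?r -` Q \<inter> space M"
    using D by (auto simp: past_def sets_vimage_algebra2)
  have ind: "indep_var (\<Pi>\<^sub>M i\<in>{..<n}. input_space) ?r
      (\<Pi>\<^sub>M i\<in>{n}. input_space) (\<lambda>\<omega>. \<lambda>i\<in>{n}. input i \<omega>)"
    by (rule indep_var_restrict[OF input_indep[of n]]) auto
  \<comment> \<open>Restriction to the block \<open>{n}\<close> yields functions on a one-point
    index set, so \<open>C\<close> is rewritten as a cylinder there; its preimage is the original
    event again.\<close>
  let ?C = "{x \<in> space (\<Pi>\<^sub>M i\<in>{n}. input_space). x n \<in> C}"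
  have "?C \<in> sets (\<Pi>\<^sub>M i\<in>{n}. input_space)"
    using C by measurable
  from indep_varD[OF ind Q(1) this]
  have "prob ((\<lambda>x. (?r x, \<lambda>i\<in>{n}. input i x)) -` (Q \<times> ?C) \<inter> space M) =
      prob D * prob ((\<lambda>\<omega>. \<lambda>i\<in>{n}. input i \<omega>) -` ?C \<inter> space M)"
    using Q(2) by simp
  moreover have "(\<lambda>\<omega>. \<lambda>i\<in>{n}. input i \<omega>) -` ?C \<inter> space M = input n -` C \<inter> space M"
    using H_cases by (auto simp: space_PiM space_pair_measure)
  moreover have "(\<lambda>x. (?r x, \<lambda>i\<in>{n}. input i x)) -` (Q \<times> ?C) \<inter> space M = D \<inter> (input n -` C \<inter> space M)"
    using H_cases by (auto simp: space_PiM space_pair_measure Q(2))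
  ultimately show ?thesis by simp
qed

text \<open>The recursion is run on the product space itself, with the coordinates as inputs: this
  presents the orbit as one fixed function of the inputs. The index set \<open>J\<close> stays
  constant during the induction.\<close>

lemma orbit_measurable:
  "{..<n} \<subseteq> J \<Longrightarrow>
    random_orbit b (\<lambda>i x. fst (x i)) (\<lambda>i x. snd (x i)) y0 n \<in> borel_measurable (\<Pi>\<^sub>M i\<in>J. input_space)"
proof (induction n)
  case (Suc n)
  let ?N = "\<Pi>\<^sub>M i\<in>J. input_space"
  let ?R = "random_orbit b (\<lambda>i x. fst (x i)) (\<lambda>i x. snd (x i)) y0 n"
  txt \<open>Continuity is only known on the phase space, so measurability is obtained for the
    extensions by \<open>0\<close>.\<close>
  define ext where "ext k y = indicator (phase_space b) y *\<^sub>R k y" for k :: "real \<Rightarrow> real" and y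
  have [measurable]: "ext f \<in> borel_measurable borel" "ext g \<in> borel_measurable borel"
    unfolding ext_def by (intro borel_measurable_continuous_on_indicator f_cont g_cont; measurable)+
  have [measurable]: "?R \<in> borel_measurable ?N"
    by (rule Suc.IH) (use Suc.prems in auto)
  have n: "n \<in> J" using Suc.prems by auto
  have [measurable]: "(\<lambda>x. x n) \<in> ?N \<rightarrow>\<^sub>M input_space"
    using n by measurable
  have [measurable]: "(\<lambda>x. fst (x n)) \<in> ?N \<rightarrow>\<^sub>M count_space {f, g}"
    "(\<lambda>x. snd (x n)) \<in> ?N \<rightarrow>\<^sub>M borel"
    by measurable
  have [measurable]: "Measurable.pred ?N (\<lambda>x. fst (x n) = f)"
    by measurable
  have "random_orbit b (\<lambda>i x. fst (x i)) (\<lambda>i x. snd (x i)) y0 (Suc n) x =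
      trunc b ((if fst (x n) = f then ext f (?R x) else ext g (?R x)) + snd (x n))"
    if "x \<in> space ?N" for x
  proof -
    have "?R x \<in> phase_space b"
      by (cases n) (auto intro: y0_in trunc_in_phase_space b_pos)
    moreover have "fst (x n) \<in> {f, g}"
      using that n by (auto simp: space_PiM space_pair_measure PiE_iff dest!: bspec[of J _ n])
    ultimately show ?thesis
      by (auto simp: ext_def)
  qed
  moreover have "(\<lambda>x. trunc b ((if fst (x n) = f then ext f (?R x) else ext g (?R x)) + snd (x n)))
      \<in> borel_measurable ?N"
    by measurable
  ultimately show ?case
    by (subst measurable_cong) auto
next
  case 0
  then show ?case
    by (subst measurable_cong[where g = "\<lambda>_. y0"]) auto
qed

text \<open>Adaptedness: \<open>Y n\<close> is the orbit function of the product space composed with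
  the tuple of the inputs before time \<open>m\<close>.\<close>

lemma Y_measurable_past:
  assumes "n \<le> m"
  shows "Y n \<in> borel_measurable (past m)"
proof -
  let ?r = "\<lambda>\<omega>. \<lambda>i\<in>{..<m}. input i \<omega>"
  have r: "?r \<in> past m \<rightarrow>\<^sub>M (\<Pi>\<^sub>M i\<in>{..<m}. input_space)"
    unfolding past_def using H_cases
    by (intro measurable_vimage_algebra1) (auto simp: space_PiM space_pair_measure)
  have "random_orbit b (\<lambda>i x. fst (x i)) (\<lambda>i x. snd (x i)) y0 n (?r \<omega>) = Y n \<omega>" for \<omega>
    using assms by (induction n) auto
  with measurable_compose[OF r orbit_measurable[of n "{..<m}"]] assms
  show ?thesis by auto
qed

lemma input_measurable_past: "i < n \<Longrightarrow> input i \<in> past n \<rightarrow>\<^sub>M input_space"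
proof -
  assume i: "i < n"
  have "(\<lambda>\<omega>. \<lambda>i\<in>{..<n}. input i \<omega>) \<in> past n \<rightarrow>\<^sub>M (\<Pi>\<^sub>M i\<in>{..<n}. input_space)"
    unfolding past_def using H_cases
    by (intro measurable_vimage_algebra1) (auto simp: space_PiM space_pair_measure)
  from measurable_compose[OF this measurable_component_singleton[of i]] i
  show ?thesis by simp
qed

lemma past_mono:
  assumes "n \<le> m"
  shows "sets (past n) \<subseteq> sets (past m)"
proof -
  have "(\<lambda>\<omega>. \<lambda>i\<in>{..<n}. input i \<omega>) \<in> past m \<rightarrow>\<^sub>M (\<Pi>\<^sub>M i\<in>{..<n}. input_space)"
    using assms by (intro measurable_restrict input_measurable_past) auto
  then show ?thesis
    unfolding past_def[of n] by (intro sets_image_in_sets) auto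
qed

lemma past_subset: "sets (past n) \<subseteq> sets M"
proof -
  have "(\<lambda>\<omega>. \<lambda>i\<in>{..<n}. input i \<omega>) \<in> M \<rightarrow>\<^sub>M (\<Pi>\<^sub>M i\<in>{..<n}. input_space)"
    by measurable
  then show ?thesis
    unfolding past_def by (intro sets_image_in_sets) auto
qed

lemma Y_measurable [measurable]: "Y n \<in> borel_measurable M"
  using measurable_mono[OF order_refl refl past_subset, of n] Y_measurable_past[of n n] by auto

section \<open>Probabilities of input patterns\<close>

text \<open>The noise has the same density at all times and the map has the same law, so one
  \<open>q\<close> serves every \<open>n\<close>; this uniformity gives the geometric decay in
  \<open>AE_leaves\<close>. Positivity comes from \<open>h\<close> being positive on an interval of
  positive length.\<close>

lemma input_prob:
  assumes c: "c \<in> {f, g}" and st: "- \<delta> \<le> s" "s < t" "t \<le> \<delta>"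
  obtains q where "0 < q" "\<And>n. prob (input n -` ({c} \<times> {s<..<t}) \<inter> space M) = q"
proof -
  define r where "r = measure (density lborel h) {s<..<t}"
  have [measurable]: "h \<in> borel_measurable lborel"
    using distributed_borel_measurable[OF eps_distr[of 0]] by simp
  have eps: "prob (eps n -` {s<..<t} \<inter> space M) = r" for n
    using distributed_distr_eq_density[OF eps_distr[of n]]
      measure_distr[of "eps n" M lborel "{s<..<t}"] by (simp add: r_def)
  have "\<not> {s<..<t} \<in> null_sets (density lborel h)"
  proof
    assume "{s<..<t} \<in> null_sets (density lborel h)"
    then have "AE x in lborel. x \<in> {s<..<t} \<longrightarrow> h x = 0"
      by (simp add: null_sets_density_iff)
    moreover have "AE x in lborel. x \<in> {s<..<t} \<longrightarrow> h x \<noteq> 0"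
    proof (intro AE_I2 impI)
      fix x assume "x \<in> {s<..<t}"
      then show "h x \<noteq> 0" using h_pos[of x] st by auto
    qed
    ultimately have "AE x in lborel. x \<notin> {s<..<t}"
      by eventually_elim auto
    then have "{s<..<t} \<in> null_sets lborel"
      by (simp add: AE_iff_null_sets)
    then show False
      using st by (simp add: null_sets_def)
  qed
  moreover have "prob_space (density lborel h)"
    using prob_space_distr[of "eps 0" lborel]
    by (simp add: distributed_distr_eq_density[OF eps_distr])
  then have "finite_measure (density lborel h)"
    by (rule prob_space.axioms(1))
  ultimately have r: "0 < r"
    unfolding r_def null_sets_def
    by (simp add: finite_measure.emeasure_eq_measure zero_less_measure_iff)
  have H: "prob (H n -` {c} \<inter> space M) = (if c = f then p else 1 - p)" for n
    using c H_f[of n] H_g[of n] by (auto simp: vimage_def Int_def conj_commute)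
  have "prob (input n -` ({c} \<times> {s<..<t}) \<inter> space M) = (if c = f then p else 1 - p) * r" for n
    using prob_input_rect[of "{n}" "\<lambda>_. {c}" "\<lambda>_. {s<..<t}"] c by (simp add: H eps)
  moreover have "0 < (if c = f then p else 1 - p) * r"
    using r p_bounds by simp
  ultimately show ?thesis
    by (rule that[rotated])
qed

lemma input_rect_in_sets: "c \<in> {f, g} \<Longrightarrow> {c} \<times> {s<..<t} \<in> sets input_space"
  by (rule pair_measureI) auto

text \<open>Each further step intersects with an event independent of the past. Measurability is
  proved together with the probability because the next step needs the enlarged event to lie in the
  past.\<close>

lemma prob_past_run:
  assumes D: "D \<in> sets (past n)" and C: "\<And>i. C i \<in> sets input_space"
  shows "D \<inter> {\<omega> \<in> space M. \<forall>i. n \<le> i \<and> i < n + k \<longrightarrow> input i \<omega> \<in> C i} \<in> sets (past (n + k)) \<and>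
    prob (D \<inter> {\<omega> \<in> space M. \<forall>i. n \<le> i \<and> i < n + k \<longrightarrow> input i \<omega> \<in> C i}) =
    prob D * (\<Prod>i<k. prob (input (n + i) -` C (n + i) \<inter> space M))"
proof (induction k)
  case 0
  have "D \<inter> {\<omega> \<in> space M. \<forall>i. n \<le> i \<and> i < n + 0 \<longrightarrow> input i \<omega> \<in> C i} = D"
    using sets.sets_into_space[OF D] unfolding space_past by auto
  then show ?case
    unfolding add_0_right lessThan_0 prod.empty mult_1_right by (simp only: D simp_thms)
next
  case (Suc k)
  let ?R = "\<lambda>k. {\<omega> \<in> space M. \<forall>i. n \<le> i \<and> i < n + k \<longrightarrow> input i \<omega> \<in> C i}"
  let ?S = "input (n + k) -` C (n + k) \<inter> space M"
  have eq: "D \<inter> ?R (Suc k) = (D \<inter> ?R k) \<inter> ?S"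
  proof -
    have "n \<le> i \<and> i < n + Suc k \<longleftrightarrow> n \<le> i \<and> i < n + k \<or> i = n + k" for i
      by arith
    then show ?thesis by blast
  qed
  have "?S \<in> sets (past (n + Suc k))"
    using measurable_sets[OF input_measurable_past[of "n + k" "n + Suc k"] C[of "n + k"]] by simp
  moreover have "D \<inter> ?R k \<in> sets (past (n + Suc k))"
    by (rule subsetD[OF past_mono[of "n + k"] conjunct1[OF Suc]]) simp
  ultimately have "D \<inter> ?R (Suc k) \<in> sets (past (n + Suc k))"
    unfolding eq by (rule sets.Int[rotated])
  moreover have "prob (D \<inter> ?R (Suc k)) = prob (D \<inter> ?R k) * prob ?S"
    unfolding eq by (rule past_indep[OF conjunct1[OF Suc] C])
  ultimately show ?case
    unfolding conjunct2[OF Suc] by (simp only: prod.lessThan_Suc mult.assoc simp_thms)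
qed

section \<open>Almost sure exit from bounded regions\<close>

text \<open>As \<open>f\<close> does not decrease the state, each step gains at least \<delta>/2
  from the noise. Only truncation at \<open>b\<close> could spoil the gain, and it is excluded
  because the next state again lies in \<open>S\<close> above \<open>a\<close>, hence below
  \<open>b\<close>.\<close>

lemma run_up:
  assumes up: "\<And>x. x \<in> S \<Longrightarrow> a \<le> x \<Longrightarrow> x \<le> f x \<and> ereal x < b"
    and noise: "\<And>i. n \<le> i \<Longrightarrow> i < n + k \<Longrightarrow> H i \<omega> = f \<and> \<delta> / 2 < eps i \<omega>"
    and stay: "\<And>i. n \<le> i \<Longrightarrow> i \<le> n + k \<Longrightarrow> Y i \<omega> \<in> S"
    and start: "a \<le> Y n \<omega>"
  shows "Y n \<omega> + real k * (\<delta> / 2) \<le> Y (n + k) \<omega>"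
  using noise stay
proof (induction k)
  case (Suc k)
  let ?y = "Y (n + k) \<omega>" and ?y' = "Y (n + Suc k) \<omega>"
  have IH: "Y n \<omega> + real k * (\<delta> / 2) \<le> ?y"
    using Suc by auto
  have "0 \<le> real k * (\<delta> / 2)" using \<delta>_pos by simp
  with IH start have a: "a \<le> ?y" by linarith
  have y: "?y \<le> f ?y" "ereal ?y < b"
    using up[OF Suc.prems(2) a] by auto
  have y': "?y' = trunc b (f ?y + eps (n + k) \<omega>)" "\<delta> / 2 < eps (n + k) \<omega>"
    using Suc.prems(1)[of "n + k"] by auto
  have "?y < ?y'"
    unfolding y' using y y'(2) \<delta>_pos b_pos by (intro less_trunc) auto
  with a up[of ?y'] Suc.prems(2)[of "n + Suc k"] have "ereal ?y' < b" by auto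
  then have "f ?y + eps (n + k) \<omega> \<le> ?y'"
    unfolding y' by (cases b) (auto simp: trunc_def split: if_splits)
  then have "?y + \<delta> / 2 \<le> ?y'" using y y'(2) by linarith
  with IH show ?case by (simp add: algebra_simps add_divide_distrib)
qed simp

text \<open>The mirror image of \<open>run_up\<close>: here truncation at 0 could spoil the loss,
  and it is excluded because the next state is positive.\<close>

lemma run_down:
  assumes down: "\<And>x. x \<in> S \<Longrightarrow> x < a \<Longrightarrow> f x \<le> x \<and> 0 < x"
    and noise: "\<And>i. n \<le> i \<Longrightarrow> i < n + k \<Longrightarrow> H i \<omega> = f \<and> eps i \<omega> < - (\<delta> / 2)"
    and stay: "\<And>i. n \<le> i \<Longrightarrow> i \<le> n + k \<Longrightarrow> Y i \<omega> \<in> S"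
    and start: "Y n \<omega> < a"
  shows "Y (n + k) \<omega> \<le> Y n \<omega> - real k * (\<delta> / 2)"
  using noise stay
proof (induction k)
  case (Suc k)
  let ?y = "Y (n + k) \<omega>" and ?y' = "Y (n + Suc k) \<omega>"
  have IH: "?y \<le> Y n \<omega> - real k * (\<delta> / 2)"
    using Suc by auto
  have "0 \<le> real k * (\<delta> / 2)" using \<delta>_pos by simp
  with IH start have a: "?y < a" by linarith
  have y: "f ?y \<le> ?y" "0 < ?y"
    using down[OF Suc.prems(2) a] by auto
  have y': "?y' = trunc b (f ?y + eps (n + k) \<omega>)" "eps (n + k) \<omega> < - (\<delta> / 2)"
    using Suc.prems(1)[of "n + k"] by auto
  have "?y' < ?y"
    unfolding y' using y y'(2) \<delta>_pos b_pos by (intro trunc_less) auto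
  with a down[of ?y'] Suc.prems(2)[of "n + Suc k"] have "0 < ?y'" by auto
  then have "?y' \<le> f ?y + eps (n + k) \<omega>"
    unfolding y' using b_pos by (cases b) (auto simp: trunc_def split: if_splits)
  then have "?y' \<le> ?y - \<delta> / 2" using y y'(2) by linarith
  with IH show ?case by (simp add: algebra_simps add_divide_distrib)
qed simp

text \<open>
  The threshold \<open>a\<close> splits \<open>S\<close> into a part to be left upwards and a part to be left downwards.
  No fixed pattern of inputs expels every starting point, so the pattern has to be chosen from
  the state at the beginning of each block of \<open>N\<close> steps.
\<close>
lemma AE_leaves:
  assumes S [measurable]: "S \<in> sets borel" and bounds: "\<And>x. x \<in> S \<Longrightarrow> l \<le> x \<and> x \<le> u"
    and up: "\<And>x. x \<in> S \<Longrightarrow> a \<le> x \<Longrightarrow> x \<le> f x \<and> ereal x < b"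
    and down: "\<And>x. x \<in> S \<Longrightarrow> x < a \<Longrightarrow> f x \<le> x \<and> 0 < x"
  shows "AE \<omega> in M. \<not> (\<exists>m. \<forall>i\<ge>m. Y i \<omega> \<in> S)"
proof -
  \<comment> \<open>\<open>N\<close> steps of size \<delta>/2 cover more than the length of
    \<open>{l..u}\<close>, so a complete run cannot stay inside \<open>S\<close>.\<close>
  obtain N where N: "(u - l) / (\<delta> / 2) < real N"
    using reals_Archimedean2 by blast
  then have N': "u - l < real N * (\<delta> / 2)"
    using \<delta>_pos by (simp add: field_simps)
  obtain qu where qu: "0 < qu" "\<And>n. prob (input n -` ({f} \<times> {\<delta>/2<..<\<delta>}) \<inter> space M) = qu"
    using input_prob[of f "\<delta>/2" \<delta>] \<delta>_pos by auto
  obtain qd where qd: "0 < qd" "\<And>n. prob (input n -` ({f} \<times> {-\<delta><..<-(\<delta>/2)}) \<inter> space M) = qd"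
    using input_prob[of f "-\<delta>" "-(\<delta>/2)"] \<delta>_pos by auto
  define q where "q = min (qu ^ N) (qd ^ N)"
  have "qu \<le> 1" using qu(2)[of 0] prob_le_1 by metis
  then have q: "0 < q" "q \<le> 1"
    using qu(1) qd(1) by (auto simp: q_def min_le_iff_disj power_le_one)
  have never: "AE \<omega> in M. \<not> (\<forall>i\<ge>m. Y i \<omega> \<in> S)" for m
  proof -
    \<comment> \<open>\<open>A k\<close> is the event of staying in \<open>S\<close> from time
      \<open>m\<close> through \<open>k\<close> blocks of length \<open>N\<close>.\<close>
    define A where "A k = {\<omega> \<in> space M. \<forall>i\<in>{m..m + k * N}. Y i \<omega> \<in> S}" for k
    have A_past: "A k \<in> sets (past (m + k * N))" for k
    proof -
      have "{\<omega> \<in> space (past (m + k * N)). Y i \<omega> \<in> S} \<in> sets (past (m + k * N))" if "i \<le> m + k * N" for i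
        by (rule measurable_sets_Collect[OF Y_measurable_past[OF that]]) auto
      then have "{\<omega> \<in> space (past (m + k * N)). \<forall>i\<in>{m..m + k * N}. Y i \<omega> \<in> S} \<in> sets (past (m + k * N))"
        by (intro sets.sets_Collect_finite_All) auto
      then show ?thesis unfolding A_def space_past .
    qed
    have A_sets [measurable]: "A k \<in> events" for k
      using A_past past_subset by blast
    have step: "prob (A (Suc k)) \<le> (1 - q) * prob (A k)" for k
    proof -
      define n where "n = m + k * N"
      define B where "B = A k \<inter> {\<omega> \<in> space M. a \<le> Y n \<omega>}"
      define C where "C = A k \<inter> {\<omega> \<in> space M. Y n \<omega> < a}"
      define U where "U = {\<omega> \<in> space M. \<forall>i. n \<le> i \<and> i < n + N \<longrightarrow> input i \<omega> \<in> {f} \<times> {\<delta>/2<..<\<delta>}}"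
      define D where "D = {\<omega> \<in> space M. \<forall>i. n \<le> i \<and> i < n + N \<longrightarrow> input i \<omega> \<in> {f} \<times> {-\<delta><..<-(\<delta>/2)}}"
      have "{\<omega> \<in> space (past n). a \<le> Y n \<omega>} \<in> sets (past n)"
        by (rule measurable_sets_Collect[OF Y_measurable_past[OF order_refl]]) simp
      then have B: "B \<in> sets (past n)"
        using A_past[of k] by (simp add: B_def n_def)
      have "{\<omega> \<in> space (past n). Y n \<omega> < a} \<in> sets (past n)"
        by (rule measurable_sets_Collect[OF Y_measurable_past[OF order_refl]]) simp
      then have C: "C \<in> sets (past n)"
        using A_past[of k] by (simp add: C_def n_def)
      have BU: "prob (B \<inter> U) = prob B * qu ^ N" "B \<inter> U \<in> events"
        using prob_past_run[OF B, of "\<lambda>_. {f} \<times> {\<delta>/2<..<\<delta>}" N] input_rect_in_sets[of f] past_subset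
        by (auto simp: U_def qu(2))
      have CD: "prob (C \<inter> D) = prob C * qd ^ N" "C \<inter> D \<in> events"
        using prob_past_run[OF C, of "\<lambda>_. {f} \<times> {-\<delta><..<-(\<delta>/2)}" N] input_rect_in_sets[of f] past_subset
        by (auto simp: D_def qd(2))
      have ev: "B \<in> events" "C \<in> events" using B C past_subset by auto
      \<comment> \<open>Surviving another block means that the expelling run for the state at time
        \<open>n\<close> did not occur.\<close>
      have sub: "A (Suc k) \<subseteq> (B - B \<inter> U) \<union> (C - C \<inter> D)"
      proof
        fix \<omega> assume \<omega>: "\<omega> \<in> A (Suc k)"
        then have M: "\<omega> \<in> space M" and S_m: "\<And>i. m \<le> i \<Longrightarrow> i \<le> m + Suc k * N \<Longrightarrow> Y i \<omega> \<in> S"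
          by (auto simp: A_def)
        have S_n: "Y i \<omega> \<in> S" if "n \<le> i" "i \<le> n + N" for i
          using that by (intro S_m) (auto simp: n_def)
        have Ak: "\<omega> \<in> A k" using M by (auto simp: A_def intro!: S_m)
        show "\<omega> \<in> (B - B \<inter> U) \<union> (C - C \<inter> D)"
        proof (cases "a \<le> Y n \<omega>")
          case True
          have "\<omega> \<notin> U"
          proof
            assume "\<omega> \<in> U"
            then have "Y n \<omega> + real N * (\<delta> / 2) \<le> Y (n + N) \<omega>"
              by (intro run_up[OF up _ S_n True]) (auto simp: U_def)
            with bounds[OF S_n[of n]] bounds[OF S_n[of "n + N"]] N' show False by auto
          qed
          with True Ak M show ?thesis by (auto simp: B_def)
        next
          case False
          have "\<omega> \<notin> D"
          proof
            assume "\<omega> \<in> D"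
            then have "Y (n + N) \<omega> \<le> Y n \<omega> - real N * (\<delta> / 2)"
              using False by (intro run_down[OF down _ S_n]) (auto simp: D_def)
            with bounds[OF S_n[of n]] bounds[OF S_n[of "n + N"]] N' show False by auto
          qed
          with False Ak M show ?thesis by (auto simp: C_def)
        qed
      qed
      have "prob (A (Suc k)) \<le> prob (B - B \<inter> U) + prob (C - C \<inter> D)"
        using ev BU(2) CD(2)
        by (intro order_trans[OF finite_measure_mono[OF sub] measure_Un_le] sets.Un sets.Diff)
      also have "\<dots> = prob B * (1 - qu ^ N) + prob C * (1 - qd ^ N)"
        using ev BU CD by (simp add: finite_measure_Diff algebra_simps)
      also have "\<dots> \<le> prob B * (1 - q) + prob C * (1 - q)"
        by (intro add_mono mult_left_mono) (auto simp: q_def)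
      also have "\<dots> = (1 - q) * (prob B + prob C)"
        by (simp add: algebra_simps)
      also have "prob B + prob C = prob (B \<union> C)"
        using ev by (intro finite_measure_Union[symmetric]) (auto simp: B_def C_def)
      also have "B \<union> C = A k"
        by (auto simp: B_def C_def A_def)
      finally show ?thesis .
    qed
    have "prob (A k) \<le> (1 - q) ^ k" for k
    proof (induction k)
      case (Suc k)
      have "(1 - q) * prob (A k) \<le> (1 - q) * (1 - q) ^ k"
        using Suc q by (intro mult_left_mono) auto
      with step[of k] show ?case by simp
    qed simp
    moreover have "(\<lambda>k. (1 - q) ^ k) \<longlonglongrightarrow> 0"
      using q by (intro LIMSEQ_power_zero) auto
    moreover have "prob {\<omega> \<in> space M. \<forall>i\<ge>m. Y i \<omega> \<in> S} \<le> prob (A k)" for k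
      by (intro finite_measure_mono) (auto simp: A_def)
    ultimately have "prob {\<omega> \<in> space M. \<forall>i\<ge>m. Y i \<omega> \<in> S} \<le> 0"
      \<comment> \<open>Staying forever is contained in every \<open>A k\<close>, whose probability
        decays geometrically.\<close>
      by (meson LIMSEQ_le_const order_trans)
    then have "prob {\<omega> \<in> space M. \<forall>i\<ge>m. Y i \<omega> \<in> S} = 0"
      by (simp add: measure_le_0_iff)
    then show ?thesis
      by (subst (asm) prob_Collect_eq_0) measurable
  qed
  then show ?thesis
    by (simp add: AE_all_countable)
qed

section \<open>Reaching a level with positive probability\<close>

text \<open>This is \<open>prob_past_run\<close> started at time 0 from the whole space; the
  prescribed map may vary with time, and every factor is positive.\<close>

lemma pattern_prob_pos:
  assumes c: "\<And>i. c i \<in> {f, g}" and st: "- \<delta> \<le> s" "s < t" "t \<le> \<delta>"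
  shows "0 < prob {\<omega> \<in> space M. \<forall>i<k. H i \<omega> = c i \<and> s < eps i \<omega> \<and> eps i \<omega> < t}"
proof -
  have "space M \<in> sets (past 0)"
    using sets.top[of "past 0"] by simp
  from conjunct2[OF prob_past_run[OF this, where C = "\<lambda>i. {c i} \<times> {s<..<t}" and k = k,
      OF input_rect_in_sets[OF c]]]
  have "prob (space M \<inter> {\<omega> \<in> space M. \<forall>i<k. input i \<omega> \<in> {c i} \<times> {s<..<t}}) =
      (\<Prod>i<k. prob (input i -` ({c i} \<times> {s<..<t}) \<inter> space M))"
    by (simp only: add_0 le0 simp_thms prob_space mult_1)
  moreover have "space M \<inter> {\<omega> \<in> space M. \<forall>i<k. input i \<omega> \<in> {c i} \<times> {s<..<t}} =
      {\<omega> \<in> space M. \<forall>i<k. H i \<omega> = c i \<and> s < eps i \<omega> \<and> eps i \<omega> < t}"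
    by auto
  moreover have "0 < (\<Prod>i<k. prob (input i -` ({c i} \<times> {s<..<t}) \<inter> space M))"
  proof (rule prod_pos)
    fix i
    obtain q where "0 < q" "\<And>n. prob (input n -` ({c i} \<times> {s<..<t}) \<inter> space M) = q"
      using input_prob[OF c[of i] st] by blast
    then show "0 < prob (input i -` ({c i} \<times> {s<..<t}) \<inter> space M)" by simp
  qed
  ultimately show ?thesis by simp
qed

text \<open>Compactness turns the strict drift inequality into a uniform margin \<eta>. Applying the
  smaller map with noise close to -\<delta> then gains at least \<eta>/2 per step until the level
  \<open>v\<close> is reached.\<close>

lemma reach_down:
  assumes v: "0 < v" "v \<le> y0"
    and drift: "\<And>x. v \<le> x \<Longrightarrow> x \<le> y0 \<Longrightarrow> min (f x) (g x) < x + \<delta>"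
  shows "\<exists>N. 0 < prob {\<omega> \<in> space M. Y N \<omega> \<le> v}"
proof -
  have "ereal v \<le> ereal y0" using v by simp
  also have "\<dots> \<le> b" using y0_in by (simp add: phase_space_def)
  finally have "v \<in> phase_space b" using v by (simp add: phase_space_def)
  then have sub: "{v..y0} \<subseteq> phase_space b"
    using y0_in by (rule phase_space_interval)
  have "continuous_on {v..y0} (\<lambda>x. min (f x) (g x) - x)"
    by (intro continuous_intros continuous_on_subset[OF f_cont sub] continuous_on_subset[OF g_cont sub])
  then obtain xm where xm: "xm \<in> {v..y0}"
      "\<And>x. x \<in> {v..y0} \<Longrightarrow> min (f x) (g x) - x \<le> min (f xm) (g xm) - xm"
    using v continuous_attains_sup[of "{v..y0}" "\<lambda>x. min (f x) (g x) - x"] by auto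
  \<comment> \<open>Capping by \<delta> keeps the noise window from -\<delta> to -\<delta> +
    \<eta>/2 inside the support of the noise.\<close>
  define \<eta> where "\<eta> = min \<delta> (\<delta> - (min (f xm) (g xm) - xm))"
  have \<eta>: "0 < \<eta>" "\<eta> \<le> \<delta>"
    using drift[of xm] xm(1) \<delta>_pos by (auto simp: \<eta>_def)
  have \<eta>_drift: "min (f x) (g x) \<le> x + \<delta> - \<eta>" if "x \<in> {v..y0}" for x
    using xm(2)[OF that] by (simp add: \<eta>_def)
  txt \<open>By monotonicity the map to apply may be chosen along the deterministic majorant \<open>r\<close>
    instead of the random orbit, so the favourable event is a product event.\<close>
  define r where "r k = max v (y0 - real k * (\<eta> / 2))" for k
  define c where "c k = (if f (r k) \<le> g (r k) then f else g)" for k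
  have r_in: "r k \<in> {v..y0}" for k
    using v \<eta> by (simp add: r_def)
  have c_mono: "c k x \<le> c k y" if "x \<in> phase_space b" "y \<in> phase_space b" "x \<le> y" for k x y
    using that f_mono g_mono by (simp add: c_def mono_on_def)
  let ?E = "\<lambda>k. {\<omega> \<in> space M. \<forall>i<k. H i \<omega> = c i \<and> - \<delta> < eps i \<omega> \<and> eps i \<omega> < - \<delta> + \<eta> / 2}"
  have below: "Y k \<omega> \<le> r k" if "\<omega> \<in> ?E k" for k \<omega>
    using that
  proof (induction k)
    case (Suc k)
    then have "Y k \<omega> \<le> r k" by simp
    then have "c k (Y k \<omega>) \<le> c k (r k)"
      using r_in[of k] sub by (intro c_mono Y_in) auto
    also have "\<dots> \<le> r k + \<delta> - \<eta>"
      using \<eta>_drift[OF r_in[of k]] by (simp add: c_def min_def split: if_splits)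
    finally have "c k (Y k \<omega>) + eps k \<omega> \<le> r k - \<eta> / 2"
      using Suc.prems by (auto dest: spec[of _ k])
    also have "\<dots> \<le> r (Suc k)"
      using \<eta> by (auto simp: r_def max_def algebra_simps add_divide_distrib)
    finally have "trunc b (c k (Y k \<omega>) + eps k \<omega>) \<le> r (Suc k)"
      using r_in[of "Suc k"] v b_pos by (intro trunc_le) auto
    then show ?case using Suc.prems by simp
  next
    case 0
    show ?case using v by (simp add: r_def)
  qed
  obtain N where "(y0 - v) / (\<eta> / 2) < real N"
    using reals_Archimedean2 by blast
  then have "r N = v"
    using \<eta> by (simp add: r_def field_simps)
  have "0 < prob (?E N)"
    using \<eta> \<delta>_pos by (intro pattern_prob_pos) (auto simp: c_def)
  also have "\<dots> \<le> prob {\<omega> \<in> space M. Y N \<omega> \<le> v}"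
  proof (rule finite_measure_mono)
    show "?E N \<subseteq> {\<omega> \<in> space M. Y N \<omega> \<le> v}"
      using below[of _ N] \<open>r N = v\<close> by auto
  qed measurable
  finally show ?thesis ..
qed

text \<open>The mirror image of \<open>reach_down\<close>, with the larger map and noise close to
  \<delta>. Since \<open>v\<close> lies in the phase space, truncation at \<open>b\<close> cannot
  push the orbit below the minorant.\<close>

lemma reach_up:
  assumes v: "y0 \<le> v" "v \<in> phase_space b"
    and drift: "\<And>x. y0 \<le> x \<Longrightarrow> x \<le> v \<Longrightarrow> x - \<delta> < max (f x) (g x)"
  shows "\<exists>N. 0 < prob {\<omega> \<in> space M. v \<le> Y N \<omega>}"
proof -
  have sub: "{y0..v} \<subseteq> phase_space b"
    using y0_in v(2) by (rule phase_space_interval)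
  have "continuous_on {y0..v} (\<lambda>x. max (f x) (g x) - x)"
    by (intro continuous_intros continuous_on_subset[OF f_cont sub] continuous_on_subset[OF g_cont sub])
  then obtain xm where xm: "xm \<in> {y0..v}"
      "\<And>x. x \<in> {y0..v} \<Longrightarrow> max (f xm) (g xm) - xm \<le> max (f x) (g x) - x"
    using v continuous_attains_inf[of "{y0..v}" "\<lambda>x. max (f x) (g x) - x"] by auto
  define \<eta> where "\<eta> = min \<delta> (\<delta> + (max (f xm) (g xm) - xm))"
  have \<eta>: "0 < \<eta>" "\<eta> \<le> \<delta>"
    using drift[of xm] xm(1) \<delta>_pos by (auto simp: \<eta>_def)
  have \<eta>_drift: "x - \<delta> + \<eta> \<le> max (f x) (g x)" if "x \<in> {y0..v}" for x
    using xm(2)[OF that] by (simp add: \<eta>_def)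
  \<comment> \<open>A deterministic minorant of the orbit; it climbs by \<eta>/2 per step until it
    stops at \<open>v\<close>.\<close>
  define r where "r k = min v (y0 + real k * (\<eta> / 2))" for k
  define c where "c k = (if g (r k) \<le> f (r k) then f else g)" for k
  have r_in: "r k \<in> {y0..v}" for k
    using v \<eta> by (simp add: r_def)
  have c_mono: "c k x \<le> c k y" if "x \<in> phase_space b" "y \<in> phase_space b" "x \<le> y" for k x y
    using that f_mono g_mono by (simp add: c_def mono_on_def)
  let ?E = "\<lambda>k. {\<omega> \<in> space M. \<forall>i<k. H i \<omega> = c i \<and> \<delta> - \<eta> / 2 < eps i \<omega> \<and> eps i \<omega> < \<delta>}"
  have above: "r k \<le> Y k \<omega>" if "\<omega> \<in> ?E k" for k \<omega>
    using that
  proof (induction k)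
    case (Suc k)
    then have "r k \<le> Y k \<omega>" by simp
    then have "c k (r k) \<le> c k (Y k \<omega>)"
      using r_in[of k] sub by (intro c_mono Y_in) auto
    moreover have "r k - \<delta> + \<eta> \<le> c k (r k)"
      using \<eta>_drift[OF r_in[of k]] by (simp add: c_def max_def split: if_splits)
    ultimately have "r k + \<eta> / 2 \<le> c k (Y k \<omega>) + eps k \<omega>"
      using Suc.prems by (auto dest: spec[of _ k])
    moreover have "r (Suc k) \<le> r k + \<eta> / 2"
      using \<eta> by (auto simp: r_def min_def algebra_simps add_divide_distrib)
    ultimately have "r (Suc k) \<le> trunc b (c k (Y k \<omega>) + eps k \<omega>)"
      using r_in[of "Suc k"] sub b_pos by (intro le_trunc) (auto simp: phase_space_def)
    then show ?case using Suc.prems by simp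
  next
    case 0
    show ?case using v by (simp add: r_def)
  qed
  obtain N where "(v - y0) / (\<eta> / 2) < real N"
    using reals_Archimedean2 by blast
  then have "r N = v"
    using \<eta> by (simp add: r_def field_simps)
  have "0 < prob (?E N)"
    using \<eta> \<delta>_pos by (intro pattern_prob_pos) (auto simp: c_def)
  also have "\<dots> \<le> prob {\<omega> \<in> space M. v \<le> Y N \<omega>}"
  proof (rule finite_measure_mono)
    show "?E N \<subseteq> {\<omega> \<in> space M. v \<le> Y N \<omega>}"
      using above[of _ N] \<open>r N = v\<close> by auto
  qed measurable
  finally show ?thesis ..
qed

section \<open>One-way barriers\<close>

text \<open>By monotonicity a state at or below \<open>u\<close> is mapped to at most
  \<open>u - \<delta>\<close>, and the noise is less than \<delta>. Starting exactly at the barrier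
  is allowed, so strictness holds only from the next step on.\<close>

lemma stays_below:
  assumes \<omega>: "\<omega> \<in> space M" "\<And>n. eps n \<omega> < \<delta>"
    and u: "u \<in> phase_space b" "0 < u" "f u \<le> u - \<delta>" "g u \<le> u - \<delta>"
    and start: "Y m \<omega> \<le> u" and "m < n"
  shows "Y n \<omega> < u"
proof -
  have step: "Y (Suc n) \<omega> < u" if "Y n \<omega> \<le> u" for n
  proof -
    have "H n \<omega> (Y n \<omega>) \<le> H n \<omega> u"
      using H_cases[OF \<omega>(1), of n] mono_onD[OF f_mono Y_in u(1) that] mono_onD[OF g_mono Y_in u(1) that]
      by auto
    also have "\<dots> \<le> u - \<delta>"
      using H_cases[OF \<omega>(1), of n] u by auto
    finally have "H n \<omega> (Y n \<omega>) + eps n \<omega> < u"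
      using \<omega>(2)[of n] by linarith
    then show ?thesis
      using trunc_less[OF _ u(2) b_pos] by simp
  qed
  have "Y (Suc m + k) \<omega> < u" for k
  proof (induction k)
    case 0
    then show ?case using step[OF start] by simp
  next
    case (Suc k)
    then show ?case using step[of "Suc m + k"] by simp
  qed
  from this[of "n - Suc m"] \<open>m < n\<close> show ?thesis by simp
qed

text \<open>The same monotonicity argument from below; truncation preserves the strict bound because
  \<open>l\<close> lies below \<open>b\<close>.\<close>

lemma stays_above:
  assumes \<omega>: "\<omega> \<in> space M" "\<And>n. - \<delta> < eps n \<omega>"
    and l: "l \<in> phase_space b" "ereal l < b" "l + \<delta> \<le> f l" "l + \<delta> \<le> g l"
    and start: "l \<le> Y m \<omega>" and "m < n"
  shows "l < Y n \<omega>"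
proof -
  have step: "l < Y (Suc n) \<omega>" if "l \<le> Y n \<omega>" for n
  proof -
    have "l + \<delta> \<le> H n \<omega> l"
      using H_cases[OF \<omega>(1), of n] l by auto
    also have "\<dots> \<le> H n \<omega> (Y n \<omega>)"
      using H_cases[OF \<omega>(1), of n] mono_onD[OF f_mono l(1) Y_in that] mono_onD[OF g_mono l(1) Y_in that]
      by auto
    finally have "l < H n \<omega> (Y n \<omega>) + eps n \<omega>"
      using \<omega>(2)[of n] by linarith
    then show ?thesis
      using less_trunc[OF _ l(2) b_pos] by simp
  qed
  have "l < Y (Suc m + k) \<omega>" for k
  proof (induction k)
    case 0
    then show ?case using step[OF start] by simp
  next
    case (Suc k)
    then show ?case using step[of "Suc m + k"] by simp
  qed
  from this[of "n - Suc m"] \<open>m < n\<close> show ?thesis by simp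
qed

end

section \<open>Extremal points of superlevel sets\<close>

text \<open>Cutting at some \<open>v\<close> in \<open>V\<close> leaves a compact set whose minimum
  cannot be \<open>s\<close>, since \<open>F s < \<delta>\<close>. The downward closed predicate
  \<open>Q\<close> expresses the right end, which may be a real bound or \<open>ereal x < b\<close>
  with \<open>b\<close> infinite.\<close>

lemma Inf_in_superlevel:
  fixes F :: "real \<Rightarrow> real"
  assumes V: "V = {x. s < x \<and> Q x \<and> \<delta> \<le> F x}" "V \<noteq> {}"
    and Q: "\<And>x y. Q y \<Longrightarrow> x \<le> y \<Longrightarrow> Q x"
    and F: "\<And>v. Q v \<Longrightarrow> continuous_on {s..v} F" "F s < \<delta>"
  shows "Inf V \<in> V"
proof -
  obtain v where v: "v \<in> V" using V by auto
  let ?W = "{s..v} \<inter> F -` {\<delta>..}"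
  have "closed ?W"
    using v V(1) by (intro continuous_closed_preimage F) auto
  moreover have "bounded ?W"
    by (rule bounded_subset[of "{s..v}"]) auto
  ultimately have cpt: "compact ?W"
    by (simp add: compact_eq_bounded_closed)
  have "v \<in> ?W" using v V(1) by auto
  obtain x0 where x0: "x0 \<in> ?W" "\<And>x. x \<in> ?W \<Longrightarrow> x0 \<le> x"
    using compact_attains_inf[OF cpt] \<open>v \<in> ?W\<close> by blast
  have "x0 \<in> V"
    using x0(1) v V(1) Q[of v x0] F(2) by (auto simp: less_le)
  moreover have "x0 \<le> x" if "x \<in> V" for x
    using x0 that V(1) by (cases "x \<le> v") auto
  ultimately have "Inf V = x0" by (intro cInf_eq_minimum)
  with \<open>x0 \<in> V\<close> show ?thesis by simp
qed

text \<open>The compact part to the right of some \<open>v\<close> in \<open>V\<close> has a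
  maximum, and \<open>F t < \<delta>\<close> keeps it away from \<open>t\<close>.\<close>

lemma Sup_in_superlevel:
  fixes F :: "real \<Rightarrow> real"
  assumes V: "V = {x. s < x \<and> x < t \<and> \<delta> \<le> F x}" "V \<noteq> {}"
    and F: "continuous_on {s..t} F" "F t < \<delta>"
  shows "Sup V \<in> V"
proof -
  obtain v where v: "v \<in> V" using V by auto
  let ?W = "{v..t} \<inter> F -` {\<delta>..}"
  have "closed ?W"
    using v V(1) by (intro continuous_closed_preimage continuous_on_subset[OF F(1)]) auto
  moreover have "bounded ?W"
    by (rule bounded_subset[of "{v..t}"]) auto
  ultimately have cpt: "compact ?W"
    by (simp add: compact_eq_bounded_closed)
  have "v \<in> ?W" using v V(1) by auto
  obtain x0 where x0: "x0 \<in> ?W" "\<And>x. x \<in> ?W \<Longrightarrow> x \<le> x0"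
    using compact_attains_sup[OF cpt] \<open>v \<in> ?W\<close> by blast
  have "x0 \<in> V"
    using x0(1) v V(1) F(2) by (auto simp: less_le)
  moreover have "x \<le> x0" if "x \<in> V" for x
    using x0 that V(1) by (cases "v \<le> x") auto
  ultimately have "Sup V = x0" by (intro cSup_eq_maximum)
  with \<open>x0 \<in> V\<close> show ?thesis by simp
qed

section \<open>Limit behaviour of the randomly switched Allee maps\<close>

theorem theorem2:
  fixes b :: ereal
    and f g :: "real \<Rightarrow> real"
    and A\<^sub>f K\<^sub>f A\<^sub>g K\<^sub>g p \<delta> y\<^sub>0 :: real
    and U\<^sub>1 U\<^sub>2 U\<^sub>3 :: "real set"
    and w\<^sub>1 w\<^sub>2 w\<^sub>3 z\<^sub>1 z\<^sub>2 p\<^sub>0 p\<^sub>1 :: real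
    and M :: "'w measure"
    and H :: "nat \<Rightarrow> 'w \<Rightarrow> real \<Rightarrow> real"
    and \<epsilon> :: "nat \<Rightarrow> 'w \<Rightarrow> real"
    and h :: "real \<Rightarrow> ennreal"
    and Y :: "nat \<Rightarrow> 'w \<Rightarrow> real"
  assumes "0 < b"
    and "allee_map b f A\<^sub>f K\<^sub>f" "continuous_on (phase_space b) f" "strict_mono_on (phase_space b) f"
    and "allee_map b g A\<^sub>g K\<^sub>g" "continuous_on (phase_space b) g" "strict_mono_on (phase_space b) g"
    and "A\<^sub>f < A\<^sub>g" "A\<^sub>g < K\<^sub>f" "K\<^sub>f < K\<^sub>g"
    and "0 < p" "p < 1"
    and "0 < \<delta>"
    and "U\<^sub>1 = {x. 0 < x \<and> x < A\<^sub>f \<and> min (x - f x) (x - g x) \<ge> \<delta>}"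
    and "U\<^sub>2 = {x. A\<^sub>g < x \<and> x < K\<^sub>f \<and> min (f x - x) (g x - x) \<ge> \<delta>}"
    and "U\<^sub>3 = {x. K\<^sub>g < x \<and> ereal x < b \<and> min (x - f x) (x - g x) \<ge> \<delta>}"
    and "U\<^sub>1 \<noteq> {}" "U\<^sub>2 \<noteq> {}" "U\<^sub>3 \<noteq> {}"
    and "\<forall>x\<in>phase_space b. \<exists>x'\<in>phase_space b. x \<le> x' \<and> min (x' - f x') (x' - g x') \<ge> \<delta>"
    and "w\<^sub>1 = Inf U\<^sub>1" "w\<^sub>2 = Inf U\<^sub>2" "w\<^sub>3 = Inf U\<^sub>3"
    and "z\<^sub>1 = Sup U\<^sub>1" "z\<^sub>2 = Sup U\<^sub>2"
    and "prob_space M"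
    and "prob_space.indep_vars M (\<lambda>_. count_space {f, g}) H UNIV"
    and "\<And>n. measure M {\<omega> \<in> space M. H n \<omega> = f} = p"
    and "\<And>n. measure M {\<omega> \<in> space M. H n \<omega> = g} = 1 - p"
    and "prob_space.indep_vars M (\<lambda>_. borel) \<epsilon> UNIV"
    and "\<And>n. distributed M lborel (\<epsilon> n) h"
    and "\<And>x. - \<delta> < x \<Longrightarrow> x < \<delta> \<Longrightarrow> 0 < h x"
    and "\<And>n. AE \<omega> in M. - \<delta> < \<epsilon> n \<omega> \<and> \<epsilon> n \<omega> < \<delta>"
    and "prob_space.indep_set M
           (sets (vimage_algebra (space M) (\<lambda>\<omega> n. H n \<omega>) (\<Pi>\<^sub>M n\<in>UNIV. count_space {f, g})))
           (sets (vimage_algebra (space M) (\<lambda>\<omega> n. \<epsilon> n \<omega>) (\<Pi>\<^sub>M n\<in>UNIV. borel)))"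
    and "y\<^sub>0 \<in> phase_space b"
    and "Y = random_orbit b H \<epsilon> y\<^sub>0"
    and "p\<^sub>0 = measure M {\<omega> \<in> space M. \<exists>n\<^sub>0. \<forall>n\<ge>n\<^sub>0. Y n \<omega> \<in> {0..<w\<^sub>1}}"
    and "p\<^sub>1 = measure M {\<omega> \<in> space M. \<exists>n\<^sub>0. \<forall>n\<ge>n\<^sub>0. Y n \<omega> \<in> {z\<^sub>2<..<w\<^sub>3}}"
  shows "(y\<^sub>0 \<in> {0..z\<^sub>1} \<longrightarrow> p\<^sub>0 = 1) \<and>
         (w\<^sub>2 \<le> y\<^sub>0 \<and> ereal y\<^sub>0 \<le> b \<longrightarrow> p\<^sub>1 = 1) \<and>
         (y\<^sub>0 \<in> {z\<^sub>1<..<w\<^sub>2} \<longrightarrow> p\<^sub>0 > 0 \<and> p\<^sub>1 > 0 \<and> p\<^sub>0 + p\<^sub>1 = 1)"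
proof -
  define F where "F x = min (x - f x) (x - g x)" for x
  define G where "G x = min (f x - x) (g x - x)" for x
  let ?ps = "phase_space b"
  have f_allee: "f \<in> ?ps \<rightarrow> ?ps" "0 < A\<^sub>f" "A\<^sub>f < K\<^sub>f" "A\<^sub>f \<in> ?ps" "f A\<^sub>f = A\<^sub>f" "K\<^sub>f \<in> ?ps" "f K\<^sub>f = K\<^sub>f"
      "0 \<in> ?ps" "f 0 = 0"
      "\<And>x. x \<in> ?ps \<Longrightarrow> 0 < x \<and> x < A\<^sub>f \<or> K\<^sub>f < x \<Longrightarrow> f x < x"
      "\<And>x. x \<in> ?ps \<Longrightarrow> A\<^sub>f < x \<Longrightarrow> x < K\<^sub>f \<Longrightarrow> x < f x"
    using assms(2) unfolding allee_map_def by blast+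
  have g_allee: "g \<in> ?ps \<rightarrow> ?ps" "0 < A\<^sub>g" "A\<^sub>g < K\<^sub>g" "A\<^sub>g \<in> ?ps" "g A\<^sub>g = A\<^sub>g" "K\<^sub>g \<in> ?ps" "g K\<^sub>g = K\<^sub>g"
      "g 0 = 0"
      "\<And>x. x \<in> ?ps \<Longrightarrow> 0 < x \<and> x < A\<^sub>g \<or> K\<^sub>g < x \<Longrightarrow> g x < x"
      "\<And>x. x \<in> ?ps \<Longrightarrow> A\<^sub>g < x \<Longrightarrow> x < K\<^sub>g \<Longrightarrow> x < g x"
    using assms(5) unfolding allee_map_def by blast+
  interpret noisy_pair M b f g p \<delta> y\<^sub>0 H \<epsilon> h
    unfolding noisy_pair_def noisy_pair_axioms_def
    using assms by (simp add: strict_mono_on_imp_mono_on)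
  have Y_eq: "Y = random_orbit b H \<epsilon> y\<^sub>0" by fact

  \<comment> \<open>The barrier points and their order\<close>
  have F_cont: "continuous_on {s..t} F" and G_cont: "continuous_on {s..t} G"
    if "s \<in> ?ps" "t \<in> ?ps" for s t
    unfolding F_def G_def
    using continuous_on_subset[OF f_cont phase_space_interval[OF that]]
      continuous_on_subset[OF g_cont phase_space_interval[OF that]]
    by - (intro continuous_intros; assumption)+
  have U1: "U\<^sub>1 = {x. 0 < x \<and> x < A\<^sub>f \<and> \<delta> \<le> F x}" and U2: "U\<^sub>2 = {x. A\<^sub>g < x \<and> x < K\<^sub>f \<and> \<delta> \<le> G x}"
    and U3: "U\<^sub>3 = {x. K\<^sub>g < x \<and> ereal x < b \<and> \<delta> \<le> F x}"
    using assms(14-16) by (auto simp: F_def G_def)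
  \<comment> \<open>At each of these points \<open>f\<close> or \<open>g\<close> has a fixed point,
    so the minimum is at most 0.\<close>
  have ends: "F 0 < \<delta>" "F A\<^sub>f < \<delta>" "G A\<^sub>g < \<delta>" "G K\<^sub>f < \<delta>" "F K\<^sub>g < \<delta>"
    using f_allee g_allee \<delta>_pos by (auto simp: F_def G_def)
  have "w\<^sub>1 \<in> U\<^sub>1"
    unfolding \<open>w\<^sub>1 = Inf U\<^sub>1\<close>
  proof (rule Inf_in_superlevel[where Q = "\<lambda>x. x < A\<^sub>f" and F = F])
    show "continuous_on {0..v} F" if "v < A\<^sub>f" for v
      by (rule continuous_on_subset[OF F_cont[OF f_allee(8,4)]]) (use that in auto)
  qed (use assms(17) U1 ends in auto)
  have "z\<^sub>1 \<in> U\<^sub>1"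
    unfolding \<open>z\<^sub>1 = Sup U\<^sub>1\<close>
    by (rule Sup_in_superlevel[OF U1 assms(17) F_cont[OF f_allee(8,4)] ends(2)])
  have "w\<^sub>2 \<in> U\<^sub>2"
    unfolding \<open>w\<^sub>2 = Inf U\<^sub>2\<close>
  proof (rule Inf_in_superlevel[where Q = "\<lambda>x. x < K\<^sub>f" and F = G])
    show "continuous_on {A\<^sub>g..v} G" if "v < K\<^sub>f" for v
      by (rule continuous_on_subset[OF G_cont[OF g_allee(4) f_allee(6)]]) (use that in auto)
  qed (use assms(18) U2 ends in auto)
  have "z\<^sub>2 \<in> U\<^sub>2"
    unfolding \<open>z\<^sub>2 = Sup U\<^sub>2\<close>
    by (rule Sup_in_superlevel[OF U2 assms(18) G_cont[OF g_allee(4) f_allee(6)] ends(4)])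
  have "w\<^sub>3 \<in> U\<^sub>3"
    unfolding \<open>w\<^sub>3 = Inf U\<^sub>3\<close>
  proof (rule Inf_in_superlevel[where Q = "\<lambda>x. ereal x < b" and F = F])
    show "continuous_on {K\<^sub>g..v} F" if "ereal v < b" for v
    proof (cases "K\<^sub>g \<le> v")
      case True
      then have "v \<in> ?ps"
        using that g_allee by (auto simp: phase_space_def)
      then show ?thesis by (rule F_cont[OF g_allee(6)])
    qed simp
    show "ereal x < b" if "ereal y < b" "x \<le> y" for x y
      using that by (metis ereal_less_eq(3) le_less_trans)
  qed (use assms(19) U3 ends in auto)
  have le1: "w\<^sub>1 \<le> z\<^sub>1"
    using \<open>z\<^sub>1 \<in> U\<^sub>1\<close> unfolding \<open>w\<^sub>1 = Inf U\<^sub>1\<close>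
    by (rule cInf_lower) (auto simp: U1 intro!: bdd_belowI[of _ 0])
  have le2: "w\<^sub>2 \<le> z\<^sub>2"
    using \<open>z\<^sub>2 \<in> U\<^sub>2\<close> unfolding \<open>w\<^sub>2 = Inf U\<^sub>2\<close>
    by (rule cInf_lower) (auto simp: U2 intro!: bdd_belowI[of _ A\<^sub>g])
  have ord: "0 < w\<^sub>1" "z\<^sub>1 < A\<^sub>f" "A\<^sub>g < w\<^sub>2" "z\<^sub>2 < K\<^sub>f" "K\<^sub>g < w\<^sub>3" "ereal w\<^sub>3 < b"
    using \<open>w\<^sub>1 \<in> U\<^sub>1\<close> \<open>z\<^sub>1 \<in> U\<^sub>1\<close> \<open>w\<^sub>2 \<in> U\<^sub>2\<close> \<open>z\<^sub>2 \<in> U\<^sub>2\<close> \<open>w\<^sub>3 \<in> U\<^sub>3\<close> by (auto simp: U1 U2 U3)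
  note order = le1 le2 ord \<open>A\<^sub>f < A\<^sub>g\<close> \<open>A\<^sub>g < K\<^sub>f\<close> \<open>K\<^sub>f < K\<^sub>g\<close>
  have below_b: "ereal x < b" if "x \<le> w\<^sub>3" for x
    using that ord(6) by (metis ereal_less_eq(3) le_less_trans)
  have in_ps: "x \<in> ?ps" if "0 \<le> x" "x \<le> w\<^sub>3" for x
    using that below_b[of x] by (auto simp: phase_space_def)
  have pts: "w\<^sub>1 \<in> ?ps" "z\<^sub>1 \<in> ?ps" "w\<^sub>2 \<in> ?ps" "z\<^sub>2 \<in> ?ps" "w\<^sub>3 \<in> ?ps"
    using order by (auto intro!: in_ps)
  have down_pts: "f x \<le> x - \<delta>" "g x \<le> x - \<delta>" if "x \<in> U\<^sub>1 \<union> U\<^sub>3" for x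
    using that by (auto simp: U1 U3 F_def)
  have up_pts: "x + \<delta> \<le> f x" "x + \<delta> \<le> g x" if "x \<in> U\<^sub>2" for x
    using that by (auto simp: U2 G_def)
  \<comment> \<open>A downward barrier beyond both the start and \<open>w\<^sub>3\<close>; it bounds
    the orbit even when \<open>b\<close> is infinite.\<close>
  obtain xs where xs: "xs \<in> ?ps" "max y\<^sub>0 w\<^sub>3 \<le> xs" "f xs \<le> xs - \<delta>" "g xs \<le> xs - \<delta>"
  proof -
    have "max y\<^sub>0 w\<^sub>3 \<in> ?ps" using y0_in pts(5) by (simp add: max_def)
    with assms(20) show ?thesis using that by fastforce
  qed

  \<comment> \<open>Almost sure exit from the regions between the barriers\<close>
  have "AE \<omega> in M. \<not> (\<exists>m. \<forall>i\<ge>m. Y i \<omega> \<in> {w\<^sub>1..z\<^sub>1})"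
    unfolding Y_eq
  \<comment> \<open>The threshold lies above the whole region, so only downward runs occur. In the
    next two regions it is likewise chosen at or beyond an end: \<open>w\<^sub>2\<close> leaves only
    upward runs, \<open>xs + 1\<close> only downward ones.\<close>
  proof (rule AE_leaves[where a = "A\<^sub>f" and l = w\<^sub>1 and u = z\<^sub>1])
    fix x assume "x \<in> {w\<^sub>1..z\<^sub>1}"
    then show "f x \<le> x \<and> 0 < x" using f_allee(10)[of x] in_ps[of x] order by auto
  qed (use order in auto)
  moreover have "AE \<omega> in M. \<not> (\<exists>m. \<forall>i\<ge>m. Y i \<omega> \<in> {w\<^sub>2..z\<^sub>2})"
    unfolding Y_eq
  proof (rule AE_leaves[where a = "w\<^sub>2" and l = w\<^sub>2 and u = z\<^sub>2])
    fix x assume "x \<in> {w\<^sub>2..z\<^sub>2}"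
    then show "x \<le> f x \<and> ereal x < b"
      using f_allee(11)[of x] in_ps[of x] order f_allee(2) below_b[of x] by auto
  qed (use order in auto)
  moreover have "AE \<omega> in M. \<not> (\<exists>m. \<forall>i\<ge>m. Y i \<omega> \<in> {w\<^sub>3..xs})"
    unfolding Y_eq
  proof (rule AE_leaves[where a = "xs + 1" and l = w\<^sub>3 and u = xs])
    fix x assume "x \<in> {w\<^sub>3..xs}"
    then show "f x \<le> x \<and> 0 < x"
      using f_allee(10)[of x] phase_space_interval[OF pts(5) xs(1)] order f_allee(2) by auto
  qed auto
  moreover have "AE \<omega> in M. \<not> (\<exists>m. \<forall>i\<ge>m. Y i \<omega> \<in> {z\<^sub>1<..<w\<^sub>2})"
    unfolding Y_eq
  \<comment> \<open>Here the threshold really splits the region: \<open>f\<close> lowers points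
    below its unstable fixed point and, as \<open>w\<^sub>2 < K\<^sub>f\<close>, does not lower the
    points from there on.\<close>
  proof (rule AE_leaves[where a = "A\<^sub>f" and l = z\<^sub>1 and u = w\<^sub>2])
    fix x assume x: "x \<in> {z\<^sub>1<..<w\<^sub>2}"
    then show "x \<le> f x \<and> ereal x < b" if "A\<^sub>f \<le> x"
      using that f_allee(5) f_allee(11)[of x] in_ps[of x] order f_allee(2) below_b[of x]
      by (cases "x = A\<^sub>f") auto
    show "f x \<le> x \<and> 0 < x" if "x < A\<^sub>f"
      using that x f_allee(10)[of x] in_ps[of x] order by auto
  qed auto
  moreover have "AE \<omega> in M. \<forall>n. - \<delta> < \<epsilon> n \<omega> \<and> \<epsilon> n \<omega> < \<delta>"
    using eps_bounds by (simp add: AE_all_countable)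
  moreover have "AE \<omega> in M. \<omega> \<in> space M" by (rule AE_space)
  ultimately have typical: "AE \<omega> in M. \<omega> \<in> space M \<and> (\<forall>n. - \<delta> < \<epsilon> n \<omega> \<and> \<epsilon> n \<omega> < \<delta>) \<and>
      (\<forall>S\<in>{{w\<^sub>1..z\<^sub>1}, {w\<^sub>2..z\<^sub>2}, {w\<^sub>3..xs}, {z\<^sub>1<..<w\<^sub>2}}. \<forall>m. \<exists>i\<ge>m. Y i \<omega> \<notin> S)"
    by eventually_elim auto

  \<comment> \<open>Absorption beyond the barriers\<close>
  let ?E0 = "\<lambda>\<omega>. \<exists>n\<^sub>0. \<forall>n\<ge>n\<^sub>0. Y n \<omega> \<in> {0..<w\<^sub>1}" and ?E1 = "\<lambda>\<omega>. \<exists>n\<^sub>0. \<forall>n\<ge>n\<^sub>0. Y n \<omega> \<in> {z\<^sub>2<..<w\<^sub>3}"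
  have Y_nonneg: "0 \<le> Y n \<omega>" for n \<omega>
    using Y_in[of n \<omega>] by (simp add: Y_eq phase_space_def)
  \<comment> \<open>The barrier \<open>z\<^sub>1\<close> confines the orbit; when it leaves
    \<open>{w\<^sub>1..z\<^sub>1}\<close> it must drop below \<open>w\<^sub>1\<close>, which is a
    barrier as well.\<close>
  have E0: "AE \<omega> in M. (\<exists>m. Y m \<omega> \<le> z\<^sub>1) \<longrightarrow> ?E0 \<omega>"
    using typical
  proof eventually_elim
    case (elim \<omega>)
    then have \<omega>: "\<omega> \<in> space M" "\<And>n. \<epsilon> n \<omega> < \<delta>" and leave: "\<And>m. \<exists>i\<ge>m. Y i \<omega> \<notin> {w\<^sub>1..z\<^sub>1}"
      by auto
    note below = stays_below[OF \<omega>, folded Y_eq]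
    show ?case
    proof
      assume "\<exists>m. Y m \<omega> \<le> z\<^sub>1"
      then obtain m where m: "Y m \<omega> \<le> z\<^sub>1" by blast
      obtain i where i: "i \<ge> m" "Y i \<omega> \<notin> {w\<^sub>1..z\<^sub>1}" using leave by blast
      have "Y i \<omega> \<le> z\<^sub>1"
        using below[OF pts(2) _ _ _ m, of i] down_pts[of z\<^sub>1] \<open>z\<^sub>1 \<in> U\<^sub>1\<close> order i m
        by (cases "i = m") auto
      with i have i': "Y i \<omega> \<le> w\<^sub>1" by auto
      have "Y n \<omega> < w\<^sub>1" if "Suc i \<le> n" for n
        using below[OF pts(1) _ _ _ i', of n] down_pts[of w\<^sub>1] \<open>w\<^sub>1 \<in> U\<^sub>1\<close> order that by auto
      with Y_nonneg show "?E0 \<omega>"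
        by (intro exI[of _ "Suc i"]) auto
    qed
  qed
  \<comment> \<open>The target interval is absorbing, so failure means never entering it. The
    barriers then forbid changing sides, and the orbit would stay forever in
    \<open>{w\<^sub>2..z\<^sub>2}\<close> or in \<open>{w\<^sub>3..xs}\<close>, both of which it
    leaves.\<close>
  have E1: "AE \<omega> in M. (\<exists>m. w\<^sub>2 \<le> Y m \<omega>) \<longrightarrow> ?E1 \<omega>"
    using typical
  proof eventually_elim
    case (elim \<omega>)
    then have \<omega>: "\<omega> \<in> space M" "\<And>n. \<epsilon> n \<omega> < \<delta>" "\<And>n. - \<delta> < \<epsilon> n \<omega>"
      and leave: "\<And>m. \<exists>i\<ge>m. Y i \<omega> \<notin> {w\<^sub>2..z\<^sub>2}" "\<And>m. \<exists>i\<ge>m. Y i \<omega> \<notin> {w\<^sub>3..xs}"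
      by auto
    have below: "Y n \<omega> < w\<^sub>3" if "Y m \<omega> \<le> w\<^sub>3" "m < n" for m n
      using stays_below[OF \<omega>(1,2), folded Y_eq, OF pts(5) _ _ _ that] down_pts[of w\<^sub>3] \<open>w\<^sub>3 \<in> U\<^sub>3\<close>
        order f_allee(2) by auto
    have above: "l < Y n \<omega>" if "l \<in> {w\<^sub>2, z\<^sub>2}" "l \<le> Y m \<omega>" "m < n" for l m n
      using stays_above[OF \<omega>(1,3), folded Y_eq, OF _ _ _ _ that(2,3)] that(1) pts up_pts[of l]
        below_b[of l] \<open>w\<^sub>2 \<in> U\<^sub>2\<close> \<open>z\<^sub>2 \<in> U\<^sub>2\<close> order by auto
    have le_xs: "Y n \<omega> \<le> xs" for n
      using stays_below[OF \<omega>(1,2), folded Y_eq, OF xs(1) _ xs(3,4), of 0 n] xs(2) order f_allee(2) Y_eq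
      by (cases n) auto
    show ?case
    proof (intro impI, rule ccontr)
      assume "\<exists>m. w\<^sub>2 \<le> Y m \<omega>" and not: "\<not> ?E1 \<omega>"
      then obtain m where m: "w\<^sub>2 \<le> Y m \<omega>" by blast
      have outside: "Y i \<omega> \<le> z\<^sub>2 \<or> w\<^sub>3 \<le> Y i \<omega>" for i
      proof (rule ccontr)
        assume i: "\<not> (Y i \<omega> \<le> z\<^sub>2 \<or> w\<^sub>3 \<le> Y i \<omega>)"
        have "\<forall>n\<ge>Suc i. Y n \<omega> \<in> {z\<^sub>2<..<w\<^sub>3}"
          using below[of i] above[of z\<^sub>2 i] i by auto
        with not show False by blast
      qed
      have ge_w2: "w\<^sub>2 \<le> Y i \<omega>" if "m \<le> i" for i
        using above[of w\<^sub>2 m i] m that by (cases "i = m") auto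
      show False
      proof (cases "Y m \<omega> \<le> z\<^sub>2")
        case True
        have "Y i \<omega> \<in> {w\<^sub>2..z\<^sub>2}" if "m \<le> i" for i
          using below[of m i] outside[of i] ge_w2[OF that] True order that by (cases "i = m") auto
        with leave(1)[of m] show False by blast
      next
        case False
        have "Y i \<omega> \<in> {w\<^sub>3..xs}" if "m \<le> i" for i
          using above[of z\<^sub>2 m i] outside[of i] False le_xs[of i] that by (cases "i = m") auto
        with leave(2)[of m] show False by blast
      qed
    qed
  qed
  have E01: "AE \<omega> in M. ?E0 \<omega> \<or> ?E1 \<omega>"
    using typical E0 E1
  proof eventually_elim
    case (elim \<omega>)
    then obtain i where "Y i \<omega> \<notin> {z\<^sub>1<..<w\<^sub>2}" by blast
    with elim show ?case by (auto simp: not_less)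
  qed
  have [measurable]: "Y n \<in> borel_measurable M" for n
    unfolding Y_eq by (rule Y_measurable)
  have p0: "p\<^sub>0 = prob {\<omega> \<in> space M. ?E0 \<omega>}" and p1: "p\<^sub>1 = prob {\<omega> \<in> space M. ?E1 \<omega>}" by fact+
  have ev: "{\<omega> \<in> space M. ?E0 \<omega>} \<in> events" "{\<omega> \<in> space M. ?E1 \<omega>} \<in> events" by measurable

  \<comment> \<open>The three ranges of the starting point\<close>
  show ?thesis
  proof (intro conjI impI)
    assume "y\<^sub>0 \<in> {0..z\<^sub>1}"
    then have "Y 0 \<omega> \<le> z\<^sub>1" for \<omega> by (simp add: Y_eq)
    with E0 have "AE \<omega> in M. ?E0 \<omega>" by fastforce
    with ev(1) show "p\<^sub>0 = 1" unfolding p0 by (simp add: prob_Collect_eq_1)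
  next
    assume "w\<^sub>2 \<le> y\<^sub>0 \<and> ereal y\<^sub>0 \<le> b"
    then have "w\<^sub>2 \<le> Y 0 \<omega>" for \<omega> by (simp add: Y_eq)
    with E1 have "AE \<omega> in M. ?E1 \<omega>" by fastforce
    with ev(2) show "p\<^sub>1 = 1" unfolding p1 by (simp add: prob_Collect_eq_1)
  next
    assume y0: "y\<^sub>0 \<in> {z\<^sub>1<..<w\<^sub>2}"
    have not_U1: "F x < \<delta>" if "z\<^sub>1 < x" "x < A\<^sub>f" for x
    proof (rule ccontr)
      assume "\<not> F x < \<delta>"
      then have "x \<in> U\<^sub>1" using that order by (simp add: U1)
      then have "x \<le> z\<^sub>1"
        unfolding \<open>z\<^sub>1 = Sup U\<^sub>1\<close> by (rule cSup_upper) (auto simp: U1 intro!: bdd_aboveI[of _ A\<^sub>f])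
      with that show False by simp
    qed
    have not_U2: "G x < \<delta>" if "A\<^sub>g < x" "x < w\<^sub>2" for x
    proof (rule ccontr)
      assume "\<not> G x < \<delta>"
      then have "x \<in> U\<^sub>2" using that order by (simp add: U2)
      then have "w\<^sub>2 \<le> x"
        unfolding \<open>w\<^sub>2 = Inf U\<^sub>2\<close> by (rule cInf_lower) (auto simp: U2 intro!: bdd_belowI[of _ A\<^sub>g])
      with that show False by simp
    qed
    have "\<exists>N. 0 < prob {\<omega> \<in> space M. Y N \<omega> \<le> z\<^sub>1}"
      unfolding Y_eq
    proof (rule reach_down)
      fix x assume x: "z\<^sub>1 \<le> x" "x \<le> y\<^sub>0"
      show "min (f x) (g x) < x + \<delta>"
      \<comment> \<open>Up to its threshold \<open>g\<close> does not raise the state; beyond it,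
        \<open>x\<close> is below the infimum of \<open>U\<^sub>2\<close>, so one of the maps raises
        it by less than \<delta>.\<close>
      proof (cases "x \<le> A\<^sub>g")
        case True
        then have "g x \<le> x"
          using g_allee(5) g_allee(9)[of x] in_ps[of x] x order by (cases "x = A\<^sub>g") auto
        then show ?thesis using \<delta>_pos by auto
      next
        case False
        then show ?thesis using not_U2[of x] x y0 by (auto simp: G_def)
      qed
    qed (use y0 order in auto)
    then obtain N where N: "0 < prob {\<omega> \<in> space M. Y N \<omega> \<le> z\<^sub>1}" by blast
    also have "\<dots> \<le> p\<^sub>0"
      \<comment> \<open>By \<open>E0\<close> the event of being at or below \<open>z\<^sub>1\<close>
        at time \<open>N\<close> lies in the absorption event up to a null set.\<close>
      unfolding p0 using E0 ev(1) by (intro finite_measure_mono_AE) auto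
    finally show "p\<^sub>0 > 0" .
    have "\<exists>N. 0 < prob {\<omega> \<in> space M. w\<^sub>2 \<le> Y N \<omega>}"
      unfolding Y_eq
    proof (rule reach_up)
      fix x assume x: "y\<^sub>0 \<le> x" "x \<le> w\<^sub>2"
      show "x - \<delta> < max (f x) (g x)"
      \<comment> \<open>From its threshold on \<open>f\<close> does not lower the state; before it,
        \<open>x\<close> exceeds the supremum of \<open>U\<^sub>1\<close>, so one of the maps lowers
        it by less than \<delta>.\<close>
      proof (cases "A\<^sub>f \<le> x")
        case True
        then have "x \<le> f x"
          using f_allee(5) f_allee(11)[of x] in_ps[of x] x order f_allee(2) by (cases "x = A\<^sub>f") auto
        then show ?thesis using \<delta>_pos by auto
      next
        case False
        then show ?thesis using not_U1[of x] x y0 by (auto simp: F_def)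
      qed
    qed (use y0 pts in auto)
    then obtain N' where N': "0 < prob {\<omega> \<in> space M. w\<^sub>2 \<le> Y N' \<omega>}" by blast
    also have "\<dots> \<le> p\<^sub>1"
      unfolding p1 using E1 ev(2) by (intro finite_measure_mono_AE) auto
    finally show "p\<^sub>1 > 0" .
    have disjoint: "{\<omega> \<in> space M. ?E0 \<omega>} \<inter> {\<omega> \<in> space M. ?E1 \<omega>} = {}"
    proof -
      have False if "\<forall>n\<ge>i. Y n \<omega> \<in> {0..<w\<^sub>1}" "\<forall>n\<ge>j. Y n \<omega> \<in> {z\<^sub>2<..<w\<^sub>3}" for i j \<omega>
        using that(1)[rule_format, of "max i j"] that(2)[rule_format, of "max i j"] order by auto
      then show ?thesis by blast
    qed
    have "{\<omega> \<in> space M. ?E0 \<omega>} \<union> {\<omega> \<in> space M. ?E1 \<omega>} = {\<omega> \<in> space M. ?E0 \<omega> \<or> ?E1 \<omega>}"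
      by blast
    moreover have "prob {\<omega> \<in> space M. ?E0 \<omega> \<or> ?E1 \<omega>} = 1"
      by (subst prob_Collect_eq_1) (use E01 in measurable)
    ultimately show "p\<^sub>0 + p\<^sub>1 = 1"
      unfolding p0 p1 using finite_measure_Union[OF ev disjoint] by simp
  qed
qed

end
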